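(* Let $(X_1,d_1)$, $(X_2,d_2)$ be disjoint strong $b$-metric spaces (respectively, $b$-metric spaces) with relaxation constants $K_1$, $K_2$. Assume that $r_1:=\operatorname{diam}_{d_1}(X_1)<\infty$, $r_2:=\operatorname{diam}_{d_2}(X_2)<\infty$, and that $X:=X_1\cup X_2$ has at least three elements. Then there exists a function $d:X\times X\to[0,+\infty)$ extending both $d_1$ and $d_2$ (that is, $d|_{X_i\times X_i}=d_i$ for $i=1,2$) such that $(X,d)$ is a strong $b$-metric space (respectively, a $b$-metric space) with relaxation constant $K:=\max\{K_1,K_2\}$ and $\operatorname{diam}_d(X)=\max\{r_1,r_2\}$.
   Context: A semimetric space is a non-empty set $X$ with a function $d:X\times X\to[0,+\infty)$ (a semimetric) such that for all $x,y\in X$: $d(x,y)=0$ iff $x=y$, and $d(x,y)=d(y,x)$. For $K\geqslant 1$, a semimetric space $(X,d)$ is a strong $b$-metric space with relaxation constant $K$ if $d(x,z)\leqslant K d(x,y)+d(y,z)$ for all $x,y,z\in X$, and a $b$-metric space with relaxation constant $K$ if $d(x,z)\leqslant K(d(x,y)+d(y,z))$ for all $x,y,z\in X$. The diameter is $\operatorname{diam}_d(A):=\sup\{d(x,y): x,y\in A\}$. The statement consists of two versions: one for strong $b$-metric spaces throughout and one for $b$-metric spaces throughout. *)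

theory Defs
  imports "HOL-Library.Extended_Real"
begin

text \<open>
  Spaces have explicit carriers: \<open>d\<close> is a total function on the ambient type, but all
  conditions on it, including nonnegativity, concern only points of the carrier \<open>X\<close>.
\<close>

locale semimetric_space =
  fixes X :: "'a set" and d :: "'a \<Rightarrow> 'a \<Rightarrow> real"
  assumes nonempty: "X \<noteq> {}"
    and nonneg: "\<lbrakk>x \<in> X; y \<in> X\<rbrakk> \<Longrightarrow> 0 \<le> d x y"
    and zero_iff: "\<lbrakk>x \<in> X; y \<in> X\<rbrakk> \<Longrightarrow> d x y = 0 \<longleftrightarrow> x = y"
    and commute: "\<lbrakk>x \<in> X; y \<in> X\<rbrakk> \<Longrightarrow> d x y = d y x"

locale strong_b_metric_space = semimetric_space X d
  for X :: "'a set" and d :: "'a \<Rightarrow> 'a \<Rightarrow> real" +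
  fixes K :: real
  assumes K_ge_1: "1 \<le> K"
    and strong_triangle: "\<lbrakk>x \<in> X; y \<in> X; z \<in> X\<rbrakk> \<Longrightarrow> d x z \<le> K * d x y + d y z"

locale b_metric_space = semimetric_space X d
  for X :: "'a set" and d :: "'a \<Rightarrow> 'a \<Rightarrow> real" +
  fixes K :: real
  assumes K_ge_1: "1 \<le> K"
    and relaxed_triangle: "\<lbrakk>x \<in> X; y \<in> X; z \<in> X\<rbrakk> \<Longrightarrow> d x z \<le> K * (d x y + d y z)"

text \<open>
  The supremum is taken in the extended reals, so an unbounded set has diameter \<open>\<infinity>\<close>
  (and the empty set \<open>-\<infinity>\<close>, which is irrelevant since carriers are nonempty).
\<close>

definition diam :: "('a \<Rightarrow> 'a \<Rightarrow> real) \<Rightarrow> 'a set \<Rightarrow> ereal" where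
  "diam d A = Sup {ereal (d x y) | x y. x \<in> A \<and> y \<in> A}"

end

theory Submission
  imports Defs
begin

text \<open>
  The idea is to put every point of \<open>X1\<close> at the same distance \<open>r\<close> from every point of \<open>X2\<close>, where
  \<open>r\<close> is the larger of the two diameters. Since \<open>r\<close> is the largest distance that occurs, it
  can be the diameter of the union; and since every triangle whose vertices are not all on one side
  has two sides of length \<open>r\<close> and a third side of length at most \<open>r\<close>, each triangle
  inequality holds for it even with constant \<open>1\<close>, hence with any constant \<open>K \<ge> 1\<close>. Triangles within
  one part keep their own constant, which may be enlarged to \<open>max K1 K2\<close>.

  What remains is to see that \<open>r\<close> is positive, so that distinct points on different sides do not
  get distance \<open>0\<close>. This is where the three points are used: two of them lie on the same side by
  the pigeonhole principle, and their distance is positive and at most \<open>r\<close>. (For two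
  one-point spaces both diameters are \<open>0\<close> and the claim fails.)
\<close>

definition glued_dist ::
  "'a set \<Rightarrow> ('a \<Rightarrow> 'a \<Rightarrow> real) \<Rightarrow> 'a set \<Rightarrow> ('a \<Rightarrow> 'a \<Rightarrow> real) \<Rightarrow> real \<Rightarrow> 'a \<Rightarrow> 'a \<Rightarrow> real" where
  "glued_dist X1 d1 X2 d2 r x y =
     (if x \<in> X1 \<and> y \<in> X1 then d1 x y else if x \<in> X2 \<and> y \<in> X2 then d2 x y else r)"

lemma dist_le_diam:
  assumes "x \<in> A" "y \<in> A"
  shows "ereal (d x y) \<le> diam d A"
  unfolding diam_def using assms by (intro Sup_upper) blast

lemma diam_le:
  assumes "\<And>x y. x \<in> A \<Longrightarrow> y \<in> A \<Longrightarrow> ereal (d x y) \<le> b"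
  shows "diam d A \<le> b"
  unfolding diam_def using assms by (intro Sup_least) blast

lemma (in semimetric_space) diam_pos:
  assumes "x \<in> X" "y \<in> X" "x \<noteq> y"
  shows "0 < diam d X"
proof -
  have "0 < ereal (d x y)"
    using nonneg[of x y] zero_iff[of x y] assms by simp
  also have "\<dots> \<le> diam d X"
    using assms by (intro dist_le_diam)
  finally show ?thesis .
qed

locale semimetric_gluing =
  M1: semimetric_space X1 d1 + M2: semimetric_space X2 d2
  for X1 X2 :: "'a set" and d1 d2 :: "'a \<Rightarrow> 'a \<Rightarrow> real" +
  fixes r :: real
  assumes disjoint: "X1 \<inter> X2 = {}"
    and r_pos: "0 < r"
    and r_eq: "max (diam d1 X1) (diam d2 X2) = ereal r"
begin

abbreviation d :: "'a \<Rightarrow> 'a \<Rightarrow> real" where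
  "d \<equiv> glued_dist X1 d1 X2 d2 r"

lemma glued_left: "x \<in> X1 \<Longrightarrow> y \<in> X1 \<Longrightarrow> d x y = d1 x y"
  by (simp add: glued_dist_def)

lemma glued_right: "x \<in> X2 \<Longrightarrow> y \<in> X2 \<Longrightarrow> d x y = d2 x y"
  using disjoint by (auto simp: glued_dist_def)

lemma glued_cross: "x \<in> X1 \<Longrightarrow> y \<in> X2 \<Longrightarrow> d x y = r" "x \<in> X2 \<Longrightarrow> y \<in> X1 \<Longrightarrow> d x y = r"
  using disjoint by (auto simp: glued_dist_def)

lemmas glued_simps = glued_left glued_right glued_cross

lemma left_le: "x \<in> X1 \<Longrightarrow> y \<in> X1 \<Longrightarrow> d1 x y \<le> r"
  using dist_le_diam[of x X1 y d1] r_eq by (metis ereal_less_eq(3) max.bounded_iff order.refl order.trans)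

lemma right_le: "x \<in> X2 \<Longrightarrow> y \<in> X2 \<Longrightarrow> d2 x y \<le> r"
  using dist_le_diam[of x X2 y d2] r_eq by (metis ereal_less_eq(3) max.bounded_iff order.refl order.trans)

lemma glued_le: "x \<in> X1 \<union> X2 \<Longrightarrow> y \<in> X1 \<union> X2 \<Longrightarrow> d x y \<le> r"
  by (auto simp: glued_simps left_le right_le)

lemma glued_semimetric: "semimetric_space (X1 \<union> X2) d"
proof
  show "X1 \<union> X2 \<noteq> {}"
    using M1.nonempty by blast
next
  fix x y
  assume xy: "x \<in> X1 \<union> X2" "y \<in> X1 \<union> X2"
  show "0 \<le> d x y"
    using xy r_pos M1.nonneg M2.nonneg by (auto simp: glued_simps)
  show "d x y = 0 \<longleftrightarrow> x = y"
    using xy r_pos disjoint M1.zero_iff M2.zero_iff by (auto simp: glued_simps)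
  show "d x y = d y x"
    using xy M1.commute M2.commute by (auto simp: glued_simps)
qed

lemma glued_diam: "diam d (X1 \<union> X2) = max (diam d1 X1) (diam d2 X2)"
proof (rule antisym)
  show "diam d (X1 \<union> X2) \<le> max (diam d1 X1) (diam d2 X2)"
    unfolding r_eq by (intro diam_le) (simp add: glued_le)
  have "diam d1 X1 \<le> diam d (X1 \<union> X2)"
    by (intro diam_le) (metis UnCI dist_le_diam glued_left)
  moreover have "diam d2 X2 \<le> diam d (X1 \<union> X2)"
    by (intro diam_le) (metis UnCI dist_le_diam glued_right)
  ultimately show "max (diam d1 X1) (diam d2 X2) \<le> diam d (X1 \<union> X2)"
    by simp
qed

text \<open>
  A triangle meeting both parts has two sides equal to the maximal distance \<open>r\<close>, so among \<open>d x y\<close>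
  and \<open>d y z\<close> at least one already dominates \<open>d x z\<close>.
\<close>

lemma mixed_triangle:
  assumes "x \<in> X1 \<union> X2" "y \<in> X1 \<union> X2" "z \<in> X1 \<union> X2"
    and "\<not> {x, y, z} \<subseteq> X1" "\<not> {x, y, z} \<subseteq> X2"
  shows "d x z \<le> d x y + d y z"
proof -
  have "d x y = r \<or> d y z = r"
    using assms by (auto simp: glued_simps)
  moreover have "0 \<le> d x y" "0 \<le> d y z"
    using semimetric_space.nonneg[OF glued_semimetric] assms by auto
  ultimately show ?thesis
    using glued_le[of x z] assms by auto
qed

lemma triangle_cases:
  assumes "x \<in> X1 \<union> X2" "y \<in> X1 \<union> X2" "z \<in> X1 \<union> X2"
  obtains (left) "x \<in> X1" "y \<in> X1" "z \<in> X1"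
    | (right) "x \<in> X2" "y \<in> X2" "z \<in> X2"
    | (mixed) "d x z \<le> d x y + d y z"
  using mixed_triangle[OF assms] by auto

lemma glued_strong_b_metric:
  assumes "strong_b_metric_space X1 d1 K1" "strong_b_metric_space X2 d2 K2"
  shows "strong_b_metric_space (X1 \<union> X2) d (max K1 K2)"
proof -
  interpret S1: strong_b_metric_space X1 d1 K1 by fact
  interpret S2: strong_b_metric_space X2 d2 K2 by fact
  interpret G: semimetric_space "X1 \<union> X2" d by (rule glued_semimetric)
  have K: "1 \<le> max K1 K2"
    using S1.K_ge_1 by simp
  show ?thesis
  proof
    show "1 \<le> max K1 K2"
      by (rule K)
  next
    fix x y z
    assume xyz: "x \<in> X1 \<union> X2" "y \<in> X1 \<union> X2" "z \<in> X1 \<union> X2"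
    have enlarge: "k * d x y \<le> max K1 K2 * d x y" if "k \<le> max K1 K2" for k
      using that G.nonneg[OF xyz(1,2)] by (rule mult_right_mono)
    from xyz show "d x z \<le> max K1 K2 * d x y + d y z"
    proof (cases rule: triangle_cases)
      case left
      then show ?thesis
        using S1.strong_triangle[of x y z] enlarge[of K1] by (simp add: glued_left)
    next
      case right
      then show ?thesis
        using S2.strong_triangle[of x y z] enlarge[of K2] by (simp add: glued_right)
    next
      case mixed
      then show ?thesis
        using enlarge[OF K] by linarith
    qed
  qed
qed

lemma glued_b_metric:
  assumes "b_metric_space X1 d1 K1" "b_metric_space X2 d2 K2"
  shows "b_metric_space (X1 \<union> X2) d (max K1 K2)"
proof -
  interpret B1: b_metric_space X1 d1 K1 by fact
  interpret B2: b_metric_space X2 d2 K2 by fact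
  interpret G: semimetric_space "X1 \<union> X2" d by (rule glued_semimetric)
  have K: "1 \<le> max K1 K2"
    using B1.K_ge_1 by simp
  show ?thesis
  proof
    show "1 \<le> max K1 K2"
      by (rule K)
  next
    fix x y z
    assume xyz: "x \<in> X1 \<union> X2" "y \<in> X1 \<union> X2" "z \<in> X1 \<union> X2"
    have "0 \<le> d x y + d y z"
      using G.nonneg xyz by simp
    then have enlarge: "k * (d x y + d y z) \<le> max K1 K2 * (d x y + d y z)"
      if "k \<le> max K1 K2" for k
      using that by (intro mult_right_mono)
    from xyz show "d x z \<le> max K1 K2 * (d x y + d y z)"
    proof (cases rule: triangle_cases)
      case left
      then show ?thesis
        using B1.relaxed_triangle[of x y z] enlarge[of K1] by (simp add: glued_left)
    next
      case right
      then show ?thesis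
        using B2.relaxed_triangle[of x y z] enlarge[of K2] by (simp add: glued_right)
    next
      case mixed
      then show ?thesis
        using enlarge[OF K] unfolding mult_1 by (rule order.trans)
    qed
  qed
qed

end

lemma semimetric_gluing_exists:
  assumes "semimetric_space X1 d1" "semimetric_space X2 d2" "X1 \<inter> X2 = {}"
    and "diam d1 X1 < \<infinity>" "diam d2 X2 < \<infinity>"
    and three: "\<exists>x\<in>X1 \<union> X2. \<exists>y\<in>X1 \<union> X2. \<exists>z\<in>X1 \<union> X2. x \<noteq> y \<and> x \<noteq> z \<and> y \<noteq> z"
  obtains r where "semimetric_gluing X1 X2 d1 d2 r"
proof -
  interpret M1: semimetric_space X1 d1 by fact
  interpret M2: semimetric_space X2 d2 by fact
  let ?D = "max (diam d1 X1) (diam d2 X2)"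
  have "(\<exists>x\<in>X1. \<exists>y\<in>X1. x \<noteq> y) \<or> (\<exists>x\<in>X2. \<exists>y\<in>X2. x \<noteq> y)"
    using three by blast
  then have pos: "0 < ?D"
    using M1.diam_pos M2.diam_pos by (auto simp: less_max_iff_disj)
  have "?D < \<infinity>"
    using assms(4,5) by (simp only: max_less_iff_conj)
  with pos obtain r where r: "?D = ereal r"
    by (cases ?D) auto
  have "semimetric_gluing X1 X2 d1 d2 r"
    by unfold_locales (use assms(3) pos r in simp_all)
  then show thesis
    by (rule that)
qed

theorem lemma3p1:
  fixes X1 X2 :: "'a set" and d1 d2 :: "'a \<Rightarrow> 'a \<Rightarrow> real" and K1 K2 :: real
  assumes "X1 \<inter> X2 = {}"
    and "diam d1 X1 < \<infinity>"
    and "diam d2 X2 < \<infinity>"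
    and "\<exists>x\<in>X1 \<union> X2. \<exists>y\<in>X1 \<union> X2. \<exists>z\<in>X1 \<union> X2. x \<noteq> y \<and> x \<noteq> z \<and> y \<noteq> z"
  shows "(strong_b_metric_space X1 d1 K1 \<and> strong_b_metric_space X2 d2 K2 \<longrightarrow>
           (\<exists>d :: 'a \<Rightarrow> 'a \<Rightarrow> real.
              (\<forall>x\<in>X1. \<forall>y\<in>X1. d x y = d1 x y) \<and>
              (\<forall>x\<in>X2. \<forall>y\<in>X2. d x y = d2 x y) \<and>
              strong_b_metric_space (X1 \<union> X2) d (max K1 K2) \<and>
              diam d (X1 \<union> X2) = max (diam d1 X1) (diam d2 X2))) \<and>
         (b_metric_space X1 d1 K1 \<and> b_metric_space X2 d2 K2 \<longrightarrow>
           (\<exists>d :: 'a \<Rightarrow> 'a \<Rightarrow> real.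
              (\<forall>x\<in>X1. \<forall>y\<in>X1. d x y = d1 x y) \<and>
              (\<forall>x\<in>X2. \<forall>y\<in>X2. d x y = d2 x y) \<and>
              b_metric_space (X1 \<union> X2) d (max K1 K2) \<and>
              diam d (X1 \<union> X2) = max (diam d1 X1) (diam d2 X2)))"
proof (intro conjI impI)
  assume "strong_b_metric_space X1 d1 K1 \<and> strong_b_metric_space X2 d2 K2"
  then have S: "strong_b_metric_space X1 d1 K1" "strong_b_metric_space X2 d2 K2"
    by simp_all
  obtain r where "semimetric_gluing X1 X2 d1 d2 r"
    using S[THEN strong_b_metric_space.axioms(1)] assms by (rule semimetric_gluing_exists)
  then interpret semimetric_gluing X1 X2 d1 d2 r .
  show "\<exists>d. (\<forall>x\<in>X1. \<forall>y\<in>X1. d x y = d1 x y) \<and> (\<forall>x\<in>X2. \<forall>y\<in>X2. d x y = d2 x y) \<and>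
          strong_b_metric_space (X1 \<union> X2) d (max K1 K2) \<and>
          diam d (X1 \<union> X2) = max (diam d1 X1) (diam d2 X2)"
    using glued_left glued_right glued_strong_b_metric[OF S] glued_diam by blast
next
  assume "b_metric_space X1 d1 K1 \<and> b_metric_space X2 d2 K2"
  then have B: "b_metric_space X1 d1 K1" "b_metric_space X2 d2 K2"
    by simp_all
  obtain r where "semimetric_gluing X1 X2 d1 d2 r"
    using B[THEN b_metric_space.axioms(1)] assms by (rule semimetric_gluing_exists)
  then interpret semimetric_gluing X1 X2 d1 d2 r .
  show "\<exists>d. (\<forall>x\<in>X1. \<forall>y\<in>X1. d x y = d1 x y) \<and> (\<forall>x\<in>X2. \<forall>y\<in>X2. d x y = d2 x y) \<and>
          b_metric_space (X1 \<union> X2) d (max K1 K2) \<and>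
          diam d (X1 \<union> X2) = max (diam d1 X1) (diam d2 X2)"
    using glued_left glued_right glued_b_metric[OF B] glued_diam by blast
qed

end
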